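(* The generating function of Motzkin N-bridges, $\sum_{w}x^{\min(w)}y^{\max(w)}t^{|w|}$ summed over all Motzkin N-bridges $w$, is algebraic.
   Context: An N-step is a non-empty finite set of integers. Motzkin N-walks are finite sequences $w=(s_1,\dots,s_n)$ of N-steps from $S_M=\{\{-1\},\{0\},\{1\},\{-1,0\},\{-1,1\},\{0,1\},\{-1,0,1\}\}$, starting at $0$; $|w|=n$. A classical walk $(v_1,\dots,v_n)$ of integers is compatible with $w$ if $v_i\in s_i$ for all $i$. The reachable points of $w$ are the endpoints $\sum_i v_i$ of all compatible walks; $\min(w)$ and $\max(w)$ are the smallest and largest reachable point. A Motzkin N-bridge is a Motzkin N-walk having $0$ as a reachable point. (Unweighted setting: every N-walk has weight $1$.) *)

theory Defs
  imports "HOL-Computational_Algebra.Computational_Algebra"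
begin

definition motzkin_nsteps :: "int set set" where
  "motzkin_nsteps = {{-1}, {0}, {1}, {-1, 0}, {-1, 1}, {0, 1}, {-1, 0, 1}}"

definition motzkin_nwalks :: "int set list set" where
  "motzkin_nwalks = lists motzkin_nsteps"

definition compatible :: "int list \<Rightarrow> int set list \<Rightarrow> bool" where
  "compatible v w \<longleftrightarrow> list_all2 (\<in>) v w"

definition reachable :: "int set list \<Rightarrow> int set" where
  "reachable w = {sum_list v |v. compatible v w}"

definition min_reach :: "int set list \<Rightarrow> int" where
  "min_reach w = Min (reachable w)"

definition max_reach :: "int set list \<Rightarrow> int" where
  "max_reach w = Max (reachable w)"

definition motzkin_nbridges :: "int set list set" where
  "motzkin_nbridges = {w \<in> motzkin_nwalks. 0 \<in> reachable w}"

text \<open>The next lemmas ensure that \<open>Min\<close> and \<open>Max\<close> above, and the sums defining the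
  generating function below, range over finite (and, for \<open>Min\<close> and \<open>Max\<close>, nonempty) sets.\<close>

lemma reachable_Nil: "reachable [] = {0}"
  by (auto simp: reachable_def compatible_def)

lemma reachable_Cons: "reachable (s # w) = (\<Union>a\<in>s. (+) a ` reachable w)"
proof (intro set_eqI iffI)
  fix k
  assume "k \<in> reachable (s # w)"
  then obtain v where v: "k = sum_list v" "list_all2 (\<in>) v (s # w)"
    unfolding reachable_def compatible_def by blast
  from v(2) obtain a v' where "v = a # v'" "a \<in> s" "list_all2 (\<in>) v' w"
    by (auto simp: list_all2_Cons2)
  with v(1) show "k \<in> (\<Union>a\<in>s. (+) a ` reachable w)"
    unfolding reachable_def compatible_def by auto
next
  fix k
  assume "k \<in> (\<Union>a\<in>s. (+) a ` reachable w)"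
  then obtain a v where "a \<in> s" "k = a + sum_list v" "list_all2 (\<in>) v w"
    unfolding reachable_def compatible_def by blast
  then have "k = sum_list (a # v)" "list_all2 (\<in>) (a # v) (s # w)"
    by simp_all
  then show "k \<in> reachable (s # w)"
    unfolding reachable_def compatible_def by blast
qed

lemma finite_motzkin_nstep: "s \<in> motzkin_nsteps \<Longrightarrow> finite s"
  unfolding motzkin_nsteps_def by fast

lemma motzkin_nstep_nonempty: "s \<in> motzkin_nsteps \<Longrightarrow> s \<noteq> {}"
  unfolding motzkin_nsteps_def by fast

lemma finite_reachable: "w \<in> motzkin_nwalks \<Longrightarrow> finite (reachable w)"
  unfolding motzkin_nwalks_def
  by (induction w rule: lists.induct) (simp_all add: reachable_Nil reachable_Cons finite_motzkin_nstep)

lemma reachable_nonempty: "w \<in> motzkin_nwalks \<Longrightarrow> reachable w \<noteq> {}"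
  unfolding motzkin_nwalks_def
  by (induction w rule: lists.induct) (simp_all add: reachable_Nil reachable_Cons motzkin_nstep_nonempty)

lemma finite_motzkin_nbridges_length: "finite {w \<in> motzkin_nbridges. length w = n}"
proof (rule finite_subset)
  show "{w \<in> motzkin_nbridges. length w = n} \<subseteq> {w. set w \<subseteq> motzkin_nsteps \<and> length w = n}"
    by (auto simp: motzkin_nbridges_def motzkin_nwalks_def)
  show "finite {w. set w \<subseteq> motzkin_nsteps \<and> length w = n}"
    by (rule finite_lists_length_eq) (simp add: motzkin_nsteps_def)
qed

text \<open>\<open>rat poly poly\<close> is \<open>\<rat>[x][y]\<close>. Since \<open>min_reach w\<close> may be negative, the coefficients of the
  generating function are Laurent polynomials; they are taken in the fraction field \<open>\<rat>(x, y)\<close>.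
  The variable \<open>t\<close> is that of the formal power series.\<close>

type_synonym rat_xy = "rat poly poly fract"

definition var_x :: rat_xy where
  "var_x = to_fract [:[:0, 1:]:]"

definition var_y :: rat_xy where
  "var_y = to_fract [:0, 1:]"

definition motzkin_nbridge_gf :: "rat_xy fps" where
  "motzkin_nbridge_gf = Abs_fps (\<lambda>n.
     \<Sum>w | w \<in> motzkin_nbridges \<and> length w = n.
       var_x powi min_reach w * var_y powi max_reach w)"

text \<open>Algebraicity over \<open>R[t]\<close>, equivalently over its fraction field: \<open>P\<close> is a polynomial in a new
  indeterminate \<open>Z\<close> with coefficients in \<open>R[t]\<close>, and the series is substituted for \<open>Z\<close>. For
  \<open>R = \<rat>[x][y]\<close> these are the nonzero polynomials \<open>P(x, y, t, Z)\<close> over \<open>\<rat>\<close>. The library constant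
  \<open>algebraic\<close> is unsuitable, as it means being a root of an integer polynomial.\<close>

definition poly_in_t :: "'a::idom poly \<Rightarrow> 'a fract fps" where
  "poly_in_t c = fps_of_poly (map_poly to_fract c)"

definition algebraic_series :: "'a::idom fract fps \<Rightarrow> bool" where
  "algebraic_series F \<longleftrightarrow> (\<exists>P :: 'a poly poly. P \<noteq> 0 \<and> poly (map_poly poly_in_t P) F = 0)"

end

theory Submission
  imports Defs
begin

text \<open>The reachable points of a walk form the interval from \<open>min(w)\<close> to \<open>max(w)\<close>, or, if all steps
  are among \<open>{-1}\<close>, \<open>{0}\<close>, \<open>{1}\<close>, \<open>{-1, 1}\<close>, every second point of it. Both ends are classical
  walks with steps \<open>-1\<close>, \<open>0\<close>, \<open>1\<close>, so a walk is a bridge iff \<open>min(w) \<le> 0 \<le> max(w)\<close> and, in the second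
  case, \<open>min(w)\<close> is even. As \<open>min(w) > 0\<close> and \<open>max(w) < 0\<close> exclude each other, the generating function
  is a combination of rational series and generating functions of weighted classical walks ending
  at positive height. Each of the latter is \<open>p + q B\<close> with \<open>p\<close>, \<open>q\<close> and \<open>B\<^sup>2\<close> rational, so the
  generating function lies in a tower of quadratic extensions of the ring of rational series.\<close>

section \<open>Elements of towers of quadratic extensions\<close>

definition is_subring :: "'a::comm_ring_1 set \<Rightarrow> bool" where
  "is_subring A \<longleftrightarrow> 1 \<in> A \<and> (\<forall>a\<in>A. \<forall>b\<in>A. a - b \<in> A \<and> a * b \<in> A)"

lemma is_subringI:
  assumes "1 \<in> A" "\<And>a b. a \<in> A \<Longrightarrow> b \<in> A \<Longrightarrow> a - b \<in> A"
    "\<And>a b. a \<in> A \<Longrightarrow> b \<in> A \<Longrightarrow> a * b \<in> A"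
  shows "is_subring A"
  using assms by (simp add: is_subring_def)

context
  fixes A :: "'a::comm_ring_1 set"
  assumes A: "is_subring A"
begin

lemma subring_one: "1 \<in> A"
  and subring_diff: "a \<in> A \<Longrightarrow> b \<in> A \<Longrightarrow> a - b \<in> A"
  and subring_mult: "a \<in> A \<Longrightarrow> b \<in> A \<Longrightarrow> a * b \<in> A"
  using A by (simp_all add: is_subring_def)

lemma subring_zero: "0 \<in> A"
  using subring_diff[OF subring_one subring_one] by simp

lemma subring_uminus: "a \<in> A \<Longrightarrow> - a \<in> A"
  using subring_diff[OF subring_zero] by fastforce

lemma subring_add: "a \<in> A \<Longrightarrow> b \<in> A \<Longrightarrow> a + b \<in> A"
  using subring_diff[OF _ subring_uminus] by fastforce

lemma subring_sum: "(\<And>i. i \<in> I \<Longrightarrow> f i \<in> A) \<Longrightarrow> sum f I \<in> A"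
  by (induction I rule: infinite_finite_induct) (auto intro: subring_zero subring_add)

lemma subring_coeff_mult:
  assumes "range (coeff p) \<subseteq> A" "range (coeff q) \<subseteq> A"
  shows "range (coeff (p * q)) \<subseteq> A"
  using assms by (auto simp: coeff_mult intro!: subring_sum subring_mult)

end

text \<open>This is the ring generated by \<open>A\<close> and \<open>s\<close> once
  \<open>s * s\<close> lies in \<open>A\<close>; the pair of coefficients need not be
  unique.\<close>

definition adjoin :: "'a::comm_ring_1 set \<Rightarrow> 'a \<Rightarrow> 'a set" where
  "adjoin A s = {a + b * s |a b. a \<in> A \<and> b \<in> A}"

lemma adjoinI: "a \<in> A \<Longrightarrow> b \<in> A \<Longrightarrow> a + b * s \<in> adjoin A s"
  unfolding adjoin_def by blast

lemma adjoin_mono: "A \<subseteq> B \<Longrightarrow> adjoin A s \<subseteq> adjoin B s"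
  unfolding adjoin_def by blast

lemma subset_adjoin: "is_subring A \<Longrightarrow> A \<subseteq> adjoin A s"
  using adjoinI[of _ A 0 s] subring_zero[of A] by auto

lemma generator_in_adjoin: "is_subring A \<Longrightarrow> s \<in> adjoin A s"
  using adjoinI[of 0 A 1 s] subring_zero[of A] subring_one[of A] by simp

lemma is_subring_adjoin:
  assumes A: "is_subring A" and s: "s * s \<in> A"
  shows "is_subring (adjoin A s)"
proof (rule is_subringI)
  show "1 \<in> adjoin A s"
    using subset_adjoin[OF A] subring_one[OF A] by blast
next
  fix x y assume "x \<in> adjoin A s" "y \<in> adjoin A s"
  then obtain a b c d where x: "x = a + b * s" and y: "y = c + d * s"
    and mem: "a \<in> A" "b \<in> A" "c \<in> A" "d \<in> A"
    unfolding adjoin_def by blast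
  have "x - y = (a - c) + (b - d) * s"
    unfolding x y by (simp add: algebra_simps)
  then show "x - y \<in> adjoin A s"
    using adjoinI subring_diff[OF A] mem by metis
  have "x * y = (a * c + b * d * (s * s)) + (a * d + b * c) * s"
    unfolding x y by (simp add: algebra_simps)
  then show "x * y \<in> adjoin A s"
    using adjoinI subring_add[OF A] subring_mult[OF A] mem s by metis
qed

text \<open>Integrality is chosen because it descends through a square root: the norm of a monic
  polynomial is monic, while the norm of a merely nonzero one may vanish when \<open>s\<close>
  already lies in \<open>A\<close>.\<close>

definition integral_over :: "'a::idom set \<Rightarrow> 'a \<Rightarrow> bool" where
  "integral_over A x \<longleftrightarrow> (\<exists>P. lead_coeff P = 1 \<and> range (coeff P) \<subseteq> A \<and> poly P x = 0)"

text \<open>A monic polynomial over \<open>A[s]\<close> is \<open>P + s Q\<close> with \<open>P\<close>, \<open>Q\<close> over \<open>A\<close> and \<open>P\<close> monic of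
  larger degree; its norm \<open>P\<^sup>2 - s\<^sup>2 Q\<^sup>2\<close> is monic over \<open>A\<close>.\<close>

lemma integral_over_adjoinD:
  assumes A: "is_subring A" and s: "s * s \<in> A" and x: "integral_over (adjoin A s) x"
  shows "integral_over A x"
proof -
  obtain R where R: "lead_coeff R = 1" "range (coeff R) \<subseteq> adjoin A s" "poly R x = 0"
    using x unfolding integral_over_def by blast
  define n where "n = degree R"
  \<comment> \<open>A positive degree is needed for \<open>degree Q < n\<close>, even if
    \<open>Q\<close> is zero.\<close>
  have "n \<noteq> 0"
  proof
    assume "n = 0"
    then have "R = [:1:]"
      using R(1) by (metis degree_0_id n_def)
    with R(3) show False by simp
  qed
  have "\<forall>i. \<exists>a b. coeff R i = a + b * s \<and> a \<in> A \<and> b \<in> A"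
    using R(2) unfolding adjoin_def by blast
  then obtain f g where fg: "coeff R i = f i + g i * s" "f i \<in> A" "g i \<in> A" for i
    by metis
  \<comment> \<open>The leading coefficient is written as 1 + 0 s, because the chosen
    \<open>f n\<close> and \<open>g n\<close> may represent 1 differently.\<close>
  define P where "P = monom 1 n + (\<Sum>i<n. monom (f i) i)"
  define Q where "Q = (\<Sum>i<n. monom (g i) i)"
  have coeff_P: "coeff P i = (if i < n then f i else if i = n then 1 else 0)" for i
    by (simp add: P_def coeff_sum)
  have coeff_Q: "coeff Q i = (if i < n then g i else 0)" for i
    by (simp add: Q_def coeff_sum)
  have deg_P: "degree P = n"
    by (rule antisym) (auto intro!: degree_le le_degree simp: coeff_P)
  have deg_Q: "degree Q < n"
    using \<open>n \<noteq> 0\<close> by (intro degree_lessI) (auto simp: coeff_Q)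
  have R_eq: "R = P + smult s Q"
  proof (rule poly_eqI)
    fix i
    consider "i < n" | "i = n" | "i > n" by linarith
    then show "coeff R i = coeff (P + smult s Q) i"
    proof cases
      case 1
      then show ?thesis by (simp add: coeff_P coeff_Q fg(1)[of i] mult.commute)
    next
      case 2
      then show ?thesis using R(1) by (simp add: coeff_P coeff_Q n_def)
    next
      case 3
      then show ?thesis by (simp add: coeff_P coeff_Q n_def coeff_eq_0)
    qed
  qed
  define N where "N = P * P - smult (s * s) (Q * Q)"
  have deg_PP: "degree (P * P) = n + n"
    using \<open>n \<noteq> 0\<close> deg_P by (subst degree_mult_eq) auto
  have deg_QQ: "degree (smult (s * s) (Q * Q)) < n + n"
    using degree_smult_le[of "s * s" "Q * Q"] degree_mult_le[of Q Q] deg_Q by linarith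
  then have "degree N = n + n"
    unfolding N_def diff_conv_add_uminus using deg_PP by (subst degree_add_eq_left) auto
  moreover have "coeff N (n + n) = coeff (P * P) (n + n)"
    using coeff_eq_0[OF deg_QQ] by (simp only: N_def coeff_diff diff_zero)
  moreover have "coeff (P * P) (n + n) = 1"
    using coeff_mult_degree_sum[of P P] by (simp add: deg_P coeff_P)
  ultimately have lead: "lead_coeff N = 1" by simp
  have "range (coeff P) \<subseteq> A" "range (coeff Q) \<subseteq> A"
    using fg(2,3) subring_zero[OF A] subring_one[OF A] by (auto simp: coeff_P coeff_Q)
  then have "range (coeff (P * P)) \<subseteq> A" "range (coeff (Q * Q)) \<subseteq> A"
    by (simp_all add: subring_coeff_mult[OF A])
  then have coeffs: "range (coeff N) \<subseteq> A"
    using s by (auto simp: N_def intro!: subring_diff[OF A] subring_mult[OF A])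
  \<comment> \<open>The norm is \<open>R\<close> times its conjugate, so it inherits the root
    \<open>x\<close>.\<close>
  have "N = R * (P - smult s Q)"
    unfolding N_def R_eq by (simp add: algebra_simps)
  with R(3) have "poly N x = 0" by simp
  with lead coeffs show ?thesis
    unfolding integral_over_def by blast
qed

section \<open>Iterated adjunction of square roots\<close>

definition tower :: "'a::comm_ring_1 set \<Rightarrow> 'a list \<Rightarrow> 'a set" where
  "tower A ss = foldr (\<lambda>s B. adjoin B s) ss A"

lemma tower_Nil [simp]: "tower A [] = A"
  and tower_Cons [simp]: "tower A (s # ss) = adjoin (tower A ss) s"
  and tower_append: "tower A (ss @ ss') = tower (tower A ss') ss"
  by (simp_all add: tower_def)

lemma tower_mono: "A \<subseteq> B \<Longrightarrow> tower A ss \<subseteq> tower B ss"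
  by (induction ss) (auto dest: adjoin_mono)

lemma subring_tower:
  assumes "is_subring A" "\<forall>s\<in>set ss. s * s \<in> A"
  shows "is_subring (tower A ss) \<and> A \<subseteq> tower A ss"
  using assms
proof (induction ss)
  case (Cons s ss)
  then have "is_subring (tower A ss)" "A \<subseteq> tower A ss" "s * s \<in> tower A ss" by auto
  then show ?case
    using is_subring_adjoin subset_adjoin by fastforce
qed simp

lemma integral_over_tower:
  assumes "is_subring A" "\<forall>s\<in>set ss. s * s \<in> A" "integral_over (tower A ss) x"
  shows "integral_over A x"
  using assms
proof (induction ss)
  case (Cons s ss)
  then have "is_subring (tower A ss)" "s * s \<in> tower A ss"
    using subring_tower[of A ss] by auto
  then have "integral_over (tower A ss) x"
    using Cons.prems(3) integral_over_adjoinD by auto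
  with Cons show ?case by simp
qed simp

text \<open>All squares lie in the base ring \<open>A\<close>, not just in the preceding level, so
  that towers for two elements can be stacked by concatenating their lists.\<close>

definition multiquadratic :: "'a::comm_ring_1 set \<Rightarrow> 'a set" where
  "multiquadratic A = {x. \<exists>ss. (\<forall>s\<in>set ss. s * s \<in> A) \<and> x \<in> tower A ss}"

lemma subset_multiquadratic: "A \<subseteq> multiquadratic A"
  unfolding multiquadratic_def by (auto intro: exI[of _ "[]"])

lemma sqrt_in_multiquadratic:
  assumes "is_subring A" "s * s \<in> A"
  shows "s \<in> multiquadratic A"
  unfolding multiquadratic_def
  using assms generator_in_adjoin by (auto intro!: exI[of _ "[s]"])

lemma is_subring_multiquadratic:
  assumes A: "is_subring A"
  shows "is_subring (multiquadratic A)"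
proof (rule is_subringI)
  show "1 \<in> multiquadratic A"
    using subset_multiquadratic subring_one[OF A] by blast
next
  fix x y assume "x \<in> multiquadratic A" "y \<in> multiquadratic A"
  then obtain ss ss' where ss: "\<forall>s\<in>set ss. s * s \<in> A" "x \<in> tower A ss"
    and ss': "\<forall>s\<in>set ss'. s * s \<in> A" "y \<in> tower A ss'"
    unfolding multiquadratic_def by blast
  let ?T = "tower A (ss @ ss')"
  have sq: "\<forall>s\<in>set (ss @ ss'). s * s \<in> A"
    using ss(1) ss'(1) by auto
  then have T: "is_subring ?T"
    using subring_tower[OF A] by blast
  have "is_subring (tower A ss')" "A \<subseteq> tower A ss'"
    using subring_tower[OF A ss'(1)] by auto
  \<comment> \<open>\<open>ss'\<close> is adjoined first: \<open>y\<close> lies in that lower tower,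
    and \<open>x\<close> stays in the tower of \<open>ss\<close> when its base grows.\<close>
  then have "x \<in> ?T" "y \<in> ?T"
    using tower_mono[of A "tower A ss'" ss] subring_tower[of "tower A ss'" ss] ss ss'
    by (auto simp: tower_append)
  then have "x - y \<in> ?T" "x * y \<in> ?T"
    using subring_diff[OF T] subring_mult[OF T] by blast+
  with sq show "x - y \<in> multiquadratic A" "x * y \<in> multiquadratic A"
    unfolding multiquadratic_def by blast+
qed

text \<open>In its own tower \<open>x\<close> is a root of the monic polynomial Z -
  \<open>x\<close>; integrality then descends one square root at a time.\<close>

lemma integral_over_multiquadratic:
  assumes A: "is_subring A" and x: "x \<in> multiquadratic A"
  shows "integral_over A x"
proof -
  obtain ss where ss: "\<forall>s\<in>set ss. s * s \<in> A" "x \<in> tower A ss"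
    using x unfolding multiquadratic_def by blast
  have T: "is_subring (tower A ss)"
    using subring_tower[OF A ss(1)] by blast
  have "coeff [:- x, 1:] i \<in> tower A ss" for i
    using subring_uminus[OF T ss(2)] subring_one[OF T] subring_zero[OF T]
    by (simp add: coeff_pCons split: nat.split)
  then have "integral_over (tower A ss) x"
    unfolding integral_over_def by (intro exI[of _ "[:- x, 1:]"]) auto
  then show ?thesis
    by (rule integral_over_tower[OF A ss(1)])
qed

section \<open>Rational series\<close>

text \<open>Quotients p / c, written multiplicatively because \<open>poly_in_t c\<close> may have
  zero constant term and thus no inverse series. Denominators of the coefficients are absorbed into
  \<open>c\<close>.\<close>

definition rational_series :: "'a::idom fract fps set" where
  "rational_series = {f. \<exists>c p :: 'a poly. c \<noteq> 0 \<and> poly_in_t c * f = poly_in_t p}"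

lemma poly_in_t_0 [simp]: "poly_in_t 0 = 0"
  and poly_in_t_1 [simp]: "poly_in_t 1 = 1"
  by (simp_all add: poly_in_t_def)

lemma poly_in_t_diff: "poly_in_t (p - q) = poly_in_t p - poly_in_t q"
  by (simp add: poly_in_t_def fps_of_poly_diff)

lemma poly_in_t_mult: "poly_in_t (p * q) = poly_in_t p * poly_in_t q"
  by (simp add: poly_in_t_def fps_of_poly_mult)

lemma poly_in_t_eq_0_iff [simp]: "poly_in_t p = 0 \<longleftrightarrow> p = 0"
  by (auto simp: poly_in_t_def fps_eq_iff poly_eq_iff coeff_map_poly)

lemma rational_seriesI: "c \<noteq> 0 \<Longrightarrow> poly_in_t c * f = poly_in_t p \<Longrightarrow> f \<in> rational_series"
  unfolding rational_series_def by blast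

lemma is_subring_rational_series: "is_subring (rational_series :: 'a::idom fract fps set)"
proof (rule is_subringI)
  show "1 \<in> (rational_series :: 'a fract fps set)"
    by (rule rational_seriesI[of 1 _ 1]) auto
next
  fix f g :: "'a fract fps"
  assume "f \<in> rational_series" "g \<in> rational_series"
  then obtain c p d q where c: "c \<noteq> 0" "poly_in_t c * f = poly_in_t p"
    and d: "d \<noteq> 0" "poly_in_t d * g = poly_in_t q"
    unfolding rational_series_def by blast
  have cd: "c * d \<noteq> 0" using c d by simp
  have "poly_in_t (c * d) * (f - g) =
      poly_in_t d * (poly_in_t c * f) - poly_in_t c * (poly_in_t d * g)"
    by (simp add: poly_in_t_mult algebra_simps)
  also have "\<dots> = poly_in_t (d * p - c * q)"
    by (simp add: c d poly_in_t_mult poly_in_t_diff)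
  finally show "f - g \<in> rational_series"
    using cd by (rule rational_seriesI[rotated])
  have "poly_in_t (c * d) * (f * g) = (poly_in_t c * f) * (poly_in_t d * g)"
    by (simp add: poly_in_t_mult algebra_simps)
  also have "\<dots> = poly_in_t (p * q)"
    by (simp add: c d poly_in_t_mult)
  finally show "f * g \<in> rational_series"
    using cd by (rule rational_seriesI[rotated])
qed

lemmas rational_series_intros =
  subring_one[OF is_subring_rational_series] subring_zero[OF is_subring_rational_series]
  subring_diff[OF is_subring_rational_series] subring_add[OF is_subring_rational_series]
  subring_mult[OF is_subring_rational_series] subring_uminus[OF is_subring_rational_series]

lemma fps_X_rational: "fps_X \<in> (rational_series :: 'a::idom fract fps set)"
proof (rule rational_seriesI[of 1 _ "monom 1 1"])
  show "poly_in_t 1 * fps_X = poly_in_t (monom 1 1 :: 'a poly)"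
    by (simp add: poly_in_t_def map_poly_monom fps_of_poly_monom)
qed simp

lemma fps_const_rational: "fps_const k \<in> (rational_series :: 'a::idom fract fps set)"
proof (cases k)
  case (Fract a b)
  show ?thesis
  proof (rule rational_seriesI[of "[:b:]" _ "[:a:]"])
    show "poly_in_t [:b:] * fps_const k = poly_in_t [:a:]"
      using Fract
      by (simp add: poly_in_t_def map_poly_pCons[of to_fract, simplified] fps_of_poly_const
          to_fract_def eq_fract del: map_poly_pCons)
  qed (use Fract in auto)
qed

text \<open>With g = p / c and g f = q / d, the quotient is f = c q / (d p); no inverse series of
  \<open>g\<close> is involved.\<close>

lemma rational_series_divide:
  assumes "g \<in> rational_series" "g \<noteq> 0" "g * f \<in> rational_series"
  shows "f \<in> (rational_series :: 'a::idom fract fps set)"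
proof -
  obtain c p d q where c: "c \<noteq> 0" "poly_in_t c * g = poly_in_t p"
    and d: "d \<noteq> 0" "poly_in_t d * (g * f) = poly_in_t q"
    using assms unfolding rational_series_def by blast
  have "p \<noteq> 0"
    using c assms(2) by (metis mult_eq_0_iff poly_in_t_eq_0_iff)
  have "poly_in_t (d * p) * f = poly_in_t c * (poly_in_t d * (g * f))"
    unfolding poly_in_t_mult c(2)[symmetric] by (simp add: algebra_simps)
  also have "\<dots> = poly_in_t (c * q)"
    by (simp add: d poly_in_t_mult)
  finally show ?thesis
    using \<open>p \<noteq> 0\<close> d(1) by (intro rational_seriesI[of "d * p"]) auto
qed

text \<open>The product of the denominators of the coefficients is a common one; it is collected
  coefficient by coefficient.\<close>

lemma clear_denominators:
  fixes P :: "'a::idom fract fps poly"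
  assumes "range (coeff P) \<subseteq> rational_series"
  shows "\<exists>c Q. c \<noteq> 0 \<and> map_poly poly_in_t Q = smult (poly_in_t c) P"
  using assms
proof (induction P)
  case 0
  show ?case by (intro exI[of _ 1] exI[of _ 0]) simp
next
  case (pCons a P)
  have "a \<in> rational_series" "range (coeff P) \<subseteq> rational_series"
    using image_subset_iff[THEN iffD1, OF pCons.prems, rule_format, of 0]
      image_subset_iff[THEN iffD1, OF pCons.prems, rule_format, of "Suc _"] by auto
  then obtain d p c Q where d: "d \<noteq> 0" "poly_in_t d * a = poly_in_t p"
    and c: "c \<noteq> 0" "map_poly poly_in_t Q = smult (poly_in_t c) P"
    using pCons.IH unfolding rational_series_def by blast
  have "map_poly poly_in_t (pCons (c * p) (smult d Q)) = smult (poly_in_t (c * d)) (pCons a P)"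
  proof (rule poly_eqI)
    fix n
    have "poly_in_t (coeff Q m) = poly_in_t c * coeff P m" for m
      using arg_cong[OF c(2), of "\<lambda>p. coeff p m"] by (simp add: coeff_map_poly)
    then show "coeff (map_poly poly_in_t (pCons (c * p) (smult d Q))) n =
        coeff (smult (poly_in_t (c * d)) (pCons a P)) n"
      using d(2) by (cases n) (auto simp: coeff_map_poly poly_in_t_mult algebra_simps)
  qed
  then show ?case
    using c(1) d(1) by (intro exI[of _ "c * d"]) auto
qed

lemma algebraic_series_if_integral:
  fixes F :: "'a::idom fract fps"
  assumes "integral_over rational_series F"
  shows "algebraic_series F"
proof -
  obtain P where P: "lead_coeff P = 1" "range (coeff P) \<subseteq> rational_series" "poly P F = 0"
    using assms unfolding integral_over_def by blast
  then obtain c Q where Q: "c \<noteq> 0" "map_poly poly_in_t Q = smult (poly_in_t c) P"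
    using clear_denominators by blast
  have "Q \<noteq> 0"
    using Q P(1) by auto
  moreover have "poly (map_poly poly_in_t Q) F = 0"
    using Q(2) P(3) by simp
  ultimately show ?thesis
    unfolding algebraic_series_def by blast
qed

lemma inverse_rational:
  assumes "f \<in> rational_series" "fps_nth f 0 \<noteq> 0"
  shows "inverse f \<in> (rational_series :: 'a::idom fract fps set)"
proof (rule rational_series_divide[OF assms(1)])
  show "f \<noteq> 0" using assms(2) by auto
  have "f * inverse f = 1"
    using inverse_mult_eq_1[OF assms(2)] by (simp add: mult.commute)
  then show "f * inverse f \<in> rational_series"
    by (simp add: rational_series_intros)
qed

section \<open>Walks with steps in \<open>{-1, 0, 1}\<close>\<close>

text \<open>The function \<open>\<phi>\<close> weights the endpoint: indicators select heights, and
  arbitrary \<open>\<phi>\<close> make the first-step recurrence closed under shifts. Steps are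
  abstract since several may share a displacement.\<close>

definition walk_gf :: "'b set \<Rightarrow> ('b \<Rightarrow> 'k::field) \<Rightarrow> ('b \<Rightarrow> int) \<Rightarrow> (int \<Rightarrow> 'k) \<Rightarrow> 'k fps" where
  "walk_gf S \<omega> d \<phi> = Abs_fps (\<lambda>n. \<Sum>w | w \<in> lists S \<and> length w = n.
     prod_list (map \<omega> w) * \<phi> (sum_list (map d w)))"

lemma sum_lists_length_Suc:
  assumes "finite S"
  shows "(\<Sum>w | w \<in> lists S \<and> length w = Suc n. f w) =
    (\<Sum>s\<in>S. \<Sum>w | w \<in> lists S \<and> length w = n. f (s # w))"
proof -
  let ?W = "{w. w \<in> lists S \<and> length w = n}"
  have "{w. w \<in> lists S \<and> length w = Suc n} = (\<lambda>(s, w). s # w) ` (S \<times> ?W)"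
    by (auto simp: length_Suc_conv image_iff)
  moreover have "inj_on (\<lambda>(s, w). s # w) (S \<times> ?W)"
    by (auto simp: inj_on_def)
  ultimately show ?thesis
    by (simp add: sum.reindex sum.cartesian_product o_def case_prod_unfold)
qed

lemma walk_gf_rec:
  assumes "finite S"
  shows "walk_gf S \<omega> d \<phi> = fps_const (\<phi> 0) +
    fps_X * (\<Sum>s\<in>S. fps_const (\<omega> s) * walk_gf S \<omega> d (\<lambda>k. \<phi> (d s + k)))"
proof (rule fps_ext)
  fix n
  show "fps_nth (walk_gf S \<omega> d \<phi>) n = fps_nth (fps_const (\<phi> 0) +
    fps_X * (\<Sum>s\<in>S. fps_const (\<omega> s) * walk_gf S \<omega> d (\<lambda>k. \<phi> (d s + k)))) n"
  proof (cases n)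
    case 0
    have "{w. w \<in> lists S \<and> length w = 0} = {[]}" by auto
    with 0 show ?thesis by (simp add: walk_gf_def)
  next
    case (Suc m)
    then show ?thesis
      by (simp add: walk_gf_def sum_lists_length_Suc[OF assms] fps_sum_nth sum_distrib_left mult.assoc)
  qed
qed

lemma walk_gf_add: "walk_gf S \<omega> d (\<lambda>k. \<phi> k + \<psi> k) = walk_gf S \<omega> d \<phi> + walk_gf S \<omega> d \<psi>"
  by (rule fps_ext) (simp add: walk_gf_def ring_distribs sum.distrib)

lemma walk_gf_diff: "walk_gf S \<omega> d (\<lambda>k. \<phi> k - \<psi> k) = walk_gf S \<omega> d \<phi> - walk_gf S \<omega> d \<psi>"
  by (rule fps_ext) (simp add: walk_gf_def ring_distribs sum_subtractf)

text \<open>The factor \<open>fps_X\<close> determines each coefficient, for all \<open>k\<close> at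
  once, from coefficients of lower order.\<close>

lemma three_term_recurrence_unique:
  fixes f g :: "int \<Rightarrow> 'a::comm_ring_1 fps"
  assumes f: "\<And>k. f k = e k + fps_X * (a * f (k + 1) + b * f k + c * f (k - 1))"
    and g: "\<And>k. g k = e k + fps_X * (a * g (k + 1) + b * g k + c * g (k - 1))"
  shows "f = g"
proof -
  have "fps_nth (f k) n = fps_nth (g k) n" for k n
  proof (induction n arbitrary: k rule: less_induct)
    case (less n)
    show ?case
    proof (cases n)
      case 0
      then show ?thesis by (subst f, subst g) simp
    next
      case (Suc m)
      have *: "fps_nth (p * f j) m = fps_nth (p * g j) m" for p j
        unfolding fps_mult_nth using less Suc by (intro sum.cong) auto
      show ?thesis
        unfolding Suc by (subst f, subst g) (simp add: *)
    qed
  qed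
  then show ?thesis by (auto simp: fps_eq_iff)
qed

text \<open>\<open>M\<close> is the compositional inverse of \<open>z / (1 + b z + q z\<^sup>2)\<close>.\<close>

lemma motzkin_series_exists:
  fixes b q :: "'k::field"
  shows "\<exists>M. M = fps_X * (1 + fps_const b * M + fps_const q * M\<^sup>2)"
proof -
  define D where "D = 1 + fps_const b * fps_X + fps_const q * fps_X\<^sup>2"
  define f where "f = fps_X * inverse D"
  define M where "M = fps_inv f"
  have D0: "fps_nth D 0 = 1"
    by (simp add: D_def power2_eq_square)
  have M0: "fps_nth M 0 = 0"
    by (simp add: M_def fps_inv_def)
  have "fps_nth f 0 = 0" "fps_nth f 1 \<noteq> 0"
    using D0 by (simp_all add: f_def)
  then have "f oo M = fps_X"
    unfolding M_def by (rule fps_inv_right)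
  then have "M * inverse (D oo M) = fps_X"
    using M0 D0 by (simp add: f_def fps_compose_mult_distrib fps_inverse_compose)
  moreover have "D oo M = 1 + fps_const b * M + fps_const q * M\<^sup>2"
    using M0 by (simp add: D_def fps_compose_add_distrib fps_compose_mult_distrib power2_eq_square)
  moreover have "inverse (D oo M) * (D oo M) = 1"
    using D0 by (intro inverse_mult_eq_1) simp
  ultimately have "M = fps_X * (1 + fps_const b * M + fps_const q * M\<^sup>2)"
    by (metis mult.assoc mult.right_neutral)
  then show ?thesis ..
qed

text \<open>The walks ending at height \<open>k \<ge> 0\<close> have generating function \<open>B (c M)\<^sup>k\<close>, those ending at
  \<open>-k\<close> have \<open>B (a M)\<^sup>k\<close>, where \<open>a\<close>, \<open>b\<close>, \<open>c\<close> are the weights of the steps \<open>-1\<close>, \<open>0\<close>, \<open>1\<close>.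
  Deleting the last step of a walk ending at positive height then expresses the
  generating function of these walks through the heights \<open>0\<close> and \<open>1\<close>.\<close>

lemma positive_walk_gf:
  fixes \<omega> :: "'b \<Rightarrow> 'k::field" and d :: "'b \<Rightarrow> int"
  assumes S: "finite S" "\<And>s. s \<in> S \<Longrightarrow> d s \<in> {-1, 0, 1}"
  defines "wt \<equiv> \<lambda>j. fps_const (\<Sum>s | s \<in> S \<and> d s = j. \<omega> s)"
  obtains B where
    "((1 - fps_X * wt 0)\<^sup>2 - 4 * fps_X\<^sup>2 * wt (-1) * wt 1) * B\<^sup>2 = 1"
    "2 * (1 - fps_X * (wt (-1) + wt 0 + wt 1)) * walk_gf S \<omega> d (\<lambda>k. if k > 0 then 1 else 0) =
      1 - (1 - fps_X * wt 0 - 2 * fps_X * wt 1) * B"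
    "(1 - fps_X * (wt (-1) + wt 0 + wt 1)) * walk_gf S \<omega> d (\<lambda>_. 1) = 1"
proof -
  define a b c where "a = wt (-1)" and "b = wt 0" and "c = wt 1"
  note wt_folds = a_def[symmetric] b_def[symmetric] c_def[symmetric]
  \<comment> \<open>Steps of equal displacement are merged, so only three weights remain.\<close>
  have split: "(\<Sum>s\<in>S. fps_const (\<omega> s) * g (d s)) = a * g (-1) + b * g 0 + c * g 1" for g
  proof -
    have "(\<Sum>s | s \<in> S \<and> d s = j. fps_const (\<omega> s) * g (d s)) = wt j * g j" for j
    proof -
      have "wt j = (\<Sum>s | s \<in> S \<and> d s = j. fps_const (\<omega> s))"
        by (rule fps_ext) (simp add: wt_def fps_sum_nth)
      then show ?thesis by (simp add: sum_distrib_right)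
    qed
    then have "(\<Sum>j\<in>{-1, 0, 1}. wt j * g j) =
        (\<Sum>j\<in>{-1, 0, 1}. \<Sum>s | s \<in> S \<and> d s = j. fps_const (\<omega> s) * g (d s))"
      by (simp only:)
    also have "\<dots> = (\<Sum>s\<in>S. fps_const (\<omega> s) * g (d s))"
      using S(2) by (intro sum.group S(1)) auto
    finally show ?thesis by (simp add: a_def b_def c_def add.assoc)
  qed
  let ?W = "walk_gf S \<omega> d"
  have rec: "?W \<phi> = fps_const (\<phi> 0) + fps_X *
      (a * ?W (\<lambda>k. \<phi> (k - 1)) + b * ?W \<phi> + c * ?W (\<lambda>k. \<phi> (k + 1)))" for \<phi>
    using split[of "\<lambda>j. ?W (\<lambda>k. \<phi> (j + k))"]
    by (subst walk_gf_rec[OF S(1)]) (simp add: add.commute)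

  obtain M where "M = fps_X * (1 + fps_const (\<Sum>s | s \<in> S \<and> d s = 0. \<omega> s) * M +
      fps_const ((\<Sum>s | s \<in> S \<and> d s = -1. \<omega> s) * (\<Sum>s | s \<in> S \<and> d s = 1. \<omega> s)) * M\<^sup>2)"
    using motzkin_series_exists by blast
  then have M: "M = fps_X * (1 + b * M + a * c * M\<^sup>2)"
    by (simp add: a_def b_def c_def wt_def)
  \<comment> \<open>The equation for \<open>M\<close> is quadratic; \<open>s\<close> is a square
    root of its discriminant.\<close>
  define s where "s = 1 - fps_X * b - 2 * fps_X * a * c * M"
  define B where "B = inverse s"
  have "fps_nth s 0 = 1" by (simp add: s_def)
  then have sB: "s * B = 1"
    using inverse_mult_eq_1[of s] by (simp add: B_def mult.commute)
  have "s\<^sup>2 = (1 - fps_X * b)\<^sup>2 - 4 * fps_X * a * c * (M - fps_X * (b * M + a * c * M\<^sup>2))"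
    unfolding s_def by algebra
  also have "M - fps_X * (b * M + a * c * M\<^sup>2) = fps_X"
    using M by algebra
  finally have s2: "s\<^sup>2 = (1 - fps_X * b)\<^sup>2 - 4 * fps_X\<^sup>2 * a * c"
    by (simp add: algebra_simps power2_eq_square)

  define H where "H k = ?W (\<lambda>j. if j = k then 1 else 0)" for k
  define G where "G k = B * (if k \<ge> 0 then (c * M) ^ nat k else (a * M) ^ nat (- k))" for k :: int
  have "H = G"
  proof (rule three_term_recurrence_unique)
    fix k
    show "H k = (if k = 0 then 1 else 0) + fps_X * (a * H (k + 1) + b * H k + c * H (k - 1))"
    proof -
      have "(\<lambda>j. if j - 1 = k then 1 else 0) = (\<lambda>j. if j = k + 1 then 1 else (0::'k))"
        "(\<lambda>j. if j + 1 = k then 1 else 0) = (\<lambda>j. if j = k - 1 then 1 else (0::'k))" by auto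
      then show ?thesis
        using rec[of "\<lambda>j. if j = k then 1 else 0"] by (cases "k = 0") (simp_all add: H_def)
    qed
    consider "k = 0" | m where "k = int m + 1" | m where "k = - int m - 1"
    proof -
      have "k = 0 \<or> k = int (nat (k - 1)) + 1 \<or> k = - int (nat (- k - 1)) - 1" by arith
      then show ?thesis
        using that(1) that(2)[of "nat (k - 1)"] that(3)[of "nat (- k - 1)"] by argo
    qed
    then show "G k = (if k = 0 then 1 else 0) + fps_X * (a * G (k + 1) + b * G k + c * G (k - 1))"
    proof cases
      case 1
      \<comment> \<open>At height 0 the recurrence is a rearrangement of
        \<open>s * B = 1\<close>.\<close>
      have "B = 1 + fps_X * (a * (B * (c * M)) + b * B + c * (B * (a * M)))"
        using sB unfolding s_def by algebra
      with 1 show ?thesis by (simp add: G_def)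
    next
      case 2
      \<comment> \<open>Away from height 0 the recurrence is the equation for \<open>M\<close>
        multiplied by \<open>B\<close>, \<open>c\<close> and a power of \<open>c * M\<close>; for
        negative heights \<open>a\<close> replaces \<open>c\<close>.\<close>
      have "(c * M) ^ Suc m = (c * M) ^ m * (c * (fps_X * (1 + b * M + a * c * M\<^sup>2)))"
        unfolding M[symmetric] by (simp add: mult_ac)
      also have "B * \<dots> = fps_X * (a * (B * (c * M) ^ Suc (Suc m)) + b * (B * (c * M) ^ Suc m) +
          c * (B * (c * M) ^ m))"
        by (simp add: algebra_simps power2_eq_square)
      finally show ?thesis
        using 2 by (simp add: G_def nat_add_distrib)
    next
      case 3
      have "(a * M) ^ Suc m = (a * M) ^ m * (a * (fps_X * (1 + b * M + a * c * M\<^sup>2)))"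
        unfolding M[symmetric] by (simp add: mult_ac)
      also have "B * \<dots> = fps_X * (a * (B * (a * M) ^ m) + b * (B * (a * M) ^ Suc m) +
          c * (B * (a * M) ^ Suc (Suc m)))"
        by (simp add: algebra_simps power2_eq_square)
      finally have *: "B * (a * M) ^ Suc m = fps_X * (a * (B * (a * M) ^ m) +
          b * (B * (a * M) ^ Suc m) + c * (B * (a * M) ^ Suc (Suc m)))" .
      have "nat (- k) = Suc m" "nat (- (k - 1)) = Suc (Suc m)" "nat (- (k + 1)) = m"
        using 3 by auto
      then have "G k = B * (a * M) ^ Suc m" "G (k - 1) = B * (a * M) ^ Suc (Suc m)"
        "G (k + 1) = B * (a * M) ^ m"
        using 3 by (auto simp: G_def)
      with * 3 show ?thesis by simp
    qed
  qed
  then have H0: "H 0 = B" and H1: "H 1 = B * (c * M)"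
    by (simp_all add: G_def)

  define P where "P = ?W (\<lambda>k. if k > 0 then 1 else 0)"
  \<comment> \<open>Shifting the condition \<open>k > 0\<close> by one step drops height 1 or adds
    height 0.\<close>
  have "?W (\<lambda>k. if k - 1 > 0 then 1 else 0) = P - H 1"
    unfolding P_def H_def walk_gf_diff[symmetric] by (rule arg_cong[where f = ?W]) auto
  moreover have "?W (\<lambda>k. if k + 1 > 0 then 1 else 0) = P + H 0"
    unfolding P_def H_def walk_gf_add[symmetric] by (rule arg_cong[where f = ?W]) auto
  ultimately have P: "P = fps_X * (a * (P - B * (c * M)) + b * P + c * (P + B))"
    using rec[of "\<lambda>k. if k > 0 then 1 else 0"] H0 H1 by (simp add: P_def)
  show thesis
  proof (rule that[of B]; (unfold wt_folds)?)
    show "((1 - fps_X * b)\<^sup>2 - 4 * fps_X\<^sup>2 * a * c) * B\<^sup>2 = 1"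
      using sB unfolding s2[symmetric] by (simp add: power_mult_distrib[symmetric])
    have "2 * (1 - fps_X * (a + b + c)) * P = 2 * fps_X * c * B - 2 * fps_X * a * c * M * B"
      using P by algebra
    \<comment> \<open>Here \<open>M\<close> is eliminated, which leaves \<open>P\<close> linear in
      \<open>B\<close>.\<close>
    also have "2 * fps_X * a * c * M * B = (1 - fps_X * b) * B - 1"
      using sB unfolding s_def by algebra
    finally have "2 * (1 - fps_X * (a + b + c)) * P = 1 - (1 - fps_X * b - 2 * fps_X * c) * B"
      by (simp add: algebra_simps)
    then show "2 * (1 - fps_X * (a + b + c)) * ?W (\<lambda>k. if k > 0 then 1 else 0) =
      1 - (1 - fps_X * b - 2 * fps_X * c) * B"
      by (simp only: P_def)
    have "?W (\<lambda>_. 1) = 1 + fps_X * (a * ?W (\<lambda>_. 1) + b * ?W (\<lambda>_. 1) + c * ?W (\<lambda>_. 1))"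
      using rec[of "\<lambda>_. 1"] by simp
    then show "(1 - fps_X * (a + b + c)) * ?W (\<lambda>_. 1) = 1"
      by algebra
  qed
qed

section \<open>Walk series as rational or multiquadratic elements\<close>

lemmas multiquadratic_intros =
  subring_diff[OF is_subring_multiquadratic[OF is_subring_rational_series]]
  subring_mult[OF is_subring_multiquadratic[OF is_subring_rational_series]]

lemma numeral_rational: "numeral n \<in> (rational_series :: 'a::idom fract fps set)"
  by (simp add: numeral_fps_const fps_const_rational)

text \<open>The total series is 1 / E. The positive one is, up to division by 2 E, linear in
  \<open>B\<close> with rational coefficients, and \<open>B\<close> is a square root of the rational
  series 1 / D.\<close>

lemma
  fixes \<omega> :: "'b \<Rightarrow> 'a::{idom,ring_char_0} fract"
  assumes S: "finite S" "\<And>s. s \<in> S \<Longrightarrow> d s \<in> {-1, 0, 1}"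
  shows all_walk_gf_rational: "walk_gf S \<omega> d (\<lambda>_. 1) \<in> rational_series"
    and positive_walk_gf_multiquadratic:
      "walk_gf S \<omega> d (\<lambda>k. if k > 0 then 1 else 0) \<in> multiquadratic rational_series"
proof -
  define wt where "wt j = fps_const (\<Sum>s | s \<in> S \<and> d s = j. \<omega> s)" for j
  have wt: "wt j \<in> rational_series" for j
    by (simp add: wt_def fps_const_rational)
  note rat = rational_series_intros fps_X_rational numeral_rational wt
  define D where "D = (1 - fps_X * wt 0)\<^sup>2 - 4 * fps_X\<^sup>2 * wt (-1) * wt 1"
  define E where "E = 1 - fps_X * (wt (-1) + wt 0 + wt 1)"
  define P where "P = walk_gf S \<omega> d (\<lambda>k. if k > 0 then 1 else 0)"
  obtain B where B: "D * B\<^sup>2 = 1"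
    "2 * E * P = 1 - (1 - fps_X * wt 0 - 2 * fps_X * wt 1) * B"
    "E * walk_gf S \<omega> d (\<lambda>_. 1) = 1"
    by (rule positive_walk_gf[of S d \<omega>, OF S, folded wt_def, folded D_def E_def P_def])
  have E: "E \<in> rational_series" "E \<noteq> 0"
    using B(3) by (auto simp: E_def intro!: rat)
  show "walk_gf S \<omega> d (\<lambda>_. 1) \<in> rational_series"
    using rational_series_divide[OF E] B(3) by (simp add: rat)
  have "D \<in> rational_series" "D \<noteq> 0"
    using B(1) by (auto simp: D_def power2_eq_square intro!: rat)
  then have "B * B \<in> rational_series"
    using rational_series_divide[of D "B\<^sup>2"] B(1) by (simp add: rat power2_eq_square)
  then have MB: "B \<in> multiquadratic rational_series"
    by (rule sqrt_in_multiquadratic[OF is_subring_rational_series])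
  have M1: "1 \<in> multiquadratic (rational_series :: 'a fract fps set)"
    and Mq: "1 - fps_X * wt 0 - 2 * fps_X * wt 1 \<in> multiquadratic rational_series"
    by (intro subsetD[OF subset_multiquadratic] rat)+
  have EP: "2 * E * P \<in> multiquadratic rational_series"
    unfolding B(2) by (rule multiquadratic_intros(1)[OF M1 multiquadratic_intros(2)[OF Mq MB]])
  \<comment> \<open>Characteristic zero is transferred to the fraction field, so that the constant
    term 2 of \<open>2 * E\<close> is invertible.\<close>
  have two: "(2::'a fract) \<noteq> 0"
  proof
    assume "(2::'a fract) = 0"
    then have "to_fract (2::'a) = to_fract 0"
      using to_fract_add[of "1::'a" 1] by (simp del: to_fract_eq_iff)
    then show False by (simp only: to_fract_eq_iff) simp
  qed
  then have 2: "fps_nth (2 * E) 0 \<noteq> 0"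
    by (simp add: E_def numeral_fps_const)
  then have "inverse (2 * E) \<in> multiquadratic rational_series"
    by (intro subsetD[OF subset_multiquadratic] inverse_rational rat E)
  then have "inverse (2 * E) * (2 * E * P) \<in> multiquadratic rational_series"
    using EP by (rule multiquadratic_intros)
  then show "P \<in> multiquadratic rational_series"
    using inverse_mult_eq_1[OF 2] by (simp add: mult.assoc[symmetric])
qed


text \<open>Because \<open>lo\<close> never exceeds \<open>hi\<close>, a positive low end and a
  negative high end are disjoint events. Subtracting both from all walks replaces the joint
  condition by conditions on one classical walk each.\<close>

lemma bridge_gf_multiquadratic:
  fixes \<omega> :: "'b \<Rightarrow> 'a::{idom,ring_char_0} fract" and lo hi :: "'b \<Rightarrow> int"
  assumes S: "finite S" "\<And>s. s \<in> S \<Longrightarrow> lo s \<in> {-1, 0, 1}" "\<And>s. s \<in> S \<Longrightarrow> hi s \<in> {-1, 0, 1}"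
    and le: "\<And>s. s \<in> S \<Longrightarrow> lo s \<le> hi s"
  shows "Abs_fps (\<lambda>n. \<Sum>w | w \<in> lists S \<and> length w = n \<and>
      sum_list (map lo w) \<le> 0 \<and> 0 \<le> sum_list (map hi w). prod_list (map \<omega> w))
    \<in> multiquadratic rational_series" (is "?U \<in> _")
proof -
  let ?pos = "\<lambda>k::int. if k > 0 then 1 else 0 :: 'a fract"
  have "?U = walk_gf S \<omega> lo (\<lambda>_. 1) - walk_gf S \<omega> lo ?pos - walk_gf S \<omega> (\<lambda>s. - hi s) ?pos"
  proof (rule fps_ext)
    fix n
    let ?W = "{w. w \<in> lists S \<and> length w = n}"
    have fin: "finite ?W"
      using finite_lists_length_eq[OF S(1), of n] by (simp add: lists_eq_set)
    have "fps_nth ?U n = (\<Sum>w | w \<in> ?W \<and> (sum_list (map lo w) \<le> 0 \<and> 0 \<le> sum_list (map hi w)).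
        prod_list (map \<omega> w))"
      by simp
    also have "\<dots> = (\<Sum>w\<in>?W. if sum_list (map lo w) \<le> 0 \<and> 0 \<le> sum_list (map hi w)
        then prod_list (map \<omega> w) else 0)"
      by (rule sum.inter_filter[OF fin])
    also have "\<dots> = (\<Sum>w\<in>?W. prod_list (map \<omega> w) * 1 -
        prod_list (map \<omega> w) * ?pos (sum_list (map lo w)) -
        prod_list (map \<omega> w) * ?pos (sum_list (map (\<lambda>s. - hi s) w)))"
    proof (rule sum.cong[OF refl])
      fix w assume "w \<in> ?W"
      then have "sum_list (map lo w) \<le> sum_list (map hi w)"
        by (intro sum_list_mono le) auto
      moreover have "sum_list (map (\<lambda>s. - hi s) w) = - sum_list (map hi w)"
        by (simp add: uminus_sum_list_map o_def)
      ultimately show "(if sum_list (map lo w) \<le> 0 \<and> 0 \<le> sum_list (map hi w)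
          then prod_list (map \<omega> w) else 0) = prod_list (map \<omega> w) * 1 -
        prod_list (map \<omega> w) * ?pos (sum_list (map lo w)) -
        prod_list (map \<omega> w) * ?pos (sum_list (map (\<lambda>s. - hi s) w))"
        by simp
    qed
    also have "\<dots> = fps_nth (walk_gf S \<omega> lo (\<lambda>_. 1) - walk_gf S \<omega> lo ?pos -
        walk_gf S \<omega> (\<lambda>s. - hi s) ?pos) n"
      by (simp only: walk_gf_def fps_sub_nth fps_nth_Abs_fps sum_subtractf)
    finally show "fps_nth ?U n = \<dots>" .
  qed
  moreover have "- hi s \<in> {-1, 0, 1}" if "s \<in> S" for s
    using S(3)[OF that] by auto
  ultimately show ?thesis
    using subsetD[OF subset_multiquadratic all_walk_gf_rational[OF S(1,2), where \<omega> = \<omega>]]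
      positive_walk_gf_multiquadratic[OF S(1,2), where \<omega> = \<omega>]
      positive_walk_gf_multiquadratic[OF S(1), where d = "\<lambda>s. - hi s" and \<omega> = \<omega>]
    by (simp add: multiquadratic_intros)
qed

section \<open>Reachable points\<close>

text \<open>The N-steps whose elements all have the same parity.\<close>

definition parity_nsteps :: "int set set" where
  "parity_nsteps = {{-1}, {0}, {1}, {-1, 1}}"

definition segment :: "bool \<Rightarrow> int \<Rightarrow> int \<Rightarrow> int set" where
  "segment b l h = {k. l \<le> k \<and> k \<le> h \<and> (b \<longrightarrow> even (k - l))}"

lemma plus_image_segment: "(+) a ` segment b l h = segment b (a + l) (a + h)"
proof (intro set_eqI iffI)
  fix k assume "k \<in> segment b (a + l) (a + h)"
  then have "k - a \<in> segment b l h"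
    by (cases "even a"; cases "even l"; auto simp: segment_def)
  then show "k \<in> (+) a ` segment b l h"
    by (rule rev_image_eqI) simp
qed (auto simp: segment_def)

lemma Min_Max_nsteps:
  "Min {-1::int} = -1" "Min {0::int} = 0" "Min {1::int} = 1" "Min {-1, 0::int} = -1"
  "Min {-1, 1::int} = -1" "Min {0, 1::int} = 0" "Min {-1, 0, 1::int} = -1"
  "Max {-1::int} = -1" "Max {0::int} = 0" "Max {1::int} = 1" "Max {-1, 0::int} = 0"
  "Max {-1, 1::int} = 1" "Max {0, 1::int} = 1" "Max {-1, 0, 1::int} = 1"
  by simp_all

lemma parity_nsteps_iff:
  "{-1} \<in> parity_nsteps" "{0} \<in> parity_nsteps" "{1} \<in> parity_nsteps" "{-1, 1} \<in> parity_nsteps"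
  "{-1, 0} \<notin> parity_nsteps" "{0, 1} \<notin> parity_nsteps" "{-1, 0, 1} \<notin> parity_nsteps"
proof -
  have "0 \<notin> s \<or> 1 \<notin> s \<and> -1 \<notin> s" if "s \<in> parity_nsteps" for s
    using that unfolding parity_nsteps_def by auto
  then show "{-1, 0} \<notin> parity_nsteps" "{0, 1} \<notin> parity_nsteps" "{-1, 0, 1} \<notin> parity_nsteps"
    by fastforce+
qed (simp_all add: parity_nsteps_def)

text \<open>The second conjunct strengthens the induction. On a full interval, \<open>l < h\<close>
  ensures that the step \<open>{-1, 1}\<close> leaves no gap; in the parity case,
  \<open>even (h - l)\<close> ensures that \<open>h\<close> itself is reached.\<close>

lemma reachable_eq_segment:
  assumes "w \<in> motzkin_nwalks"
  defines "l \<equiv> sum_list (map Min w)" and "h \<equiv> sum_list (map Max w)"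
    and "b \<equiv> w \<in> lists parity_nsteps"
  shows "reachable w = segment b l h \<and> (if b then l \<le> h \<and> even (h - l) else l < h)"
  using assms(1) unfolding motzkin_nwalks_def l_def h_def b_def
proof (induction w)
  case Nil
  then show ?case by (auto simp: reachable_Nil segment_def)
next
  case (Cons s w)
  define l where "l = sum_list (map Min w)"
  define h where "h = sum_list (map Max w)"
  define b where "b = (w \<in> lists parity_nsteps)"
  have IH: "reachable w = segment b l h" "if b then l \<le> h \<and> even (h - l) else l < h"
    using Cons.IH[folded l_def h_def b_def] by blast+
  have eq: "w \<in> lists parity_nsteps \<longleftrightarrow> b" "sum_list (map Min (s # w)) = Min s + l"
    "sum_list (map Max (s # w)) = Max s + h"
    "s # w \<in> lists parity_nsteps \<longleftrightarrow> s \<in> parity_nsteps \<and> b"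
    by (simp_all add: l_def h_def b_def)
  have "s \<in> motzkin_nsteps" using Cons.hyps by simp
  then consider "s = {-1}" | "s = {0}" | "s = {1}" | "s = {-1, 0}" | "s = {-1, 1}" | "s = {0, 1}"
    | "s = {-1, 0, 1}"
    unfolding motzkin_nsteps_def by blast
  then show ?case
    unfolding eq(2-4) reachable_Cons IH(1) plus_image_segment
    by cases (use IH(2) in \<open>simp only: parity_nsteps_iff Min_Max_nsteps;
        auto simp: segment_def split: if_splits; presburger\<close>)+
qed

section \<open>Bridges, extreme points and weights in terms of the steps\<close>

lemma bridge_iff:
  assumes "w \<in> motzkin_nwalks"
  shows "w \<in> motzkin_nbridges \<longleftrightarrow> sum_list (map Min w) \<le> 0 \<and> 0 \<le> sum_list (map Max w) \<and>
    (w \<in> lists parity_nsteps \<longrightarrow> even (sum_list (map Min w)))"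
  using reachable_eq_segment[OF assms] assms by (auto simp: motzkin_nbridges_def segment_def)

lemma Min_segment:
  assumes "l \<le> h"
  shows "Min (segment b l h) = l"
  using assms by (intro Min_eqI finite_subset[of "segment b l h" "{l..h}"]) (auto simp: segment_def)

lemma Max_segment:
  assumes "l \<le> h" "b \<longrightarrow> even (h - l)"
  shows "Max (segment b l h) = h"
  using assms by (intro Max_eqI finite_subset[of "segment b l h" "{l..h}"]) (auto simp: segment_def)

lemma min_max_reach:
  assumes "w \<in> motzkin_nwalks"
  shows "min_reach w = sum_list (map Min w)" "max_reach w = sum_list (map Max w)"
  using reachable_eq_segment[OF assms]
  by (auto simp: min_reach_def max_reach_def Min_segment Max_segment split: if_splits)

lemma prod_list_powi:
  assumes "x \<noteq> (0::'a::field)"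
  shows "prod_list (map (\<lambda>s. x powi f s) w) = x powi sum_list (map f w)"
  using assms by (induction w) (simp_all add: power_int_add)

lemma prod_list_map_mult:
  "prod_list (map (\<lambda>s. f s * g s) w) = prod_list (map f w) * (prod_list (map g w) :: 'a::comm_monoid_mult)"
  by (induction w) (simp_all add: ac_simps)

text \<open>The walks with \<open>min(w) \<le> 0 \<le> max(w)\<close> that are not bridges have all steps in
  \<open>parity_nsteps\<close> and an odd minimum; changing the weight of each step \<open>s\<close> by the factor
  \<open>(-1)\<close> to the power \<open>Min s\<close> singles them out.\<close>

theorem theorem3p4: "algebraic_series motzkin_nbridge_gf"
proof -
  define \<omega> where "\<omega> = (\<lambda>s. var_x powi Min s * var_y powi Max s)"
  define \<omega>' where "\<omega>' = (\<lambda>s. (-1) powi Min s * \<omega> s)"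
  define W where "W S n = {w. w \<in> lists S \<and> length w = n \<and>
    sum_list (map Min w) \<le> 0 \<and> 0 \<le> sum_list (map Max w)}" for S :: "int set set" and n
  define U where "U S \<rho> = Abs_fps (\<lambda>n. \<Sum>w\<in>W S n. prod_list (map \<rho> w))"
    for S and \<rho> :: "int set \<Rightarrow> rat_xy"
  have sub: "parity_nsteps \<subseteq> motzkin_nsteps"
    by (auto simp: parity_nsteps_def motzkin_nsteps_def)
  have U: "U S \<rho> \<in> multiquadratic rational_series" if "S \<subseteq> motzkin_nsteps" for S \<rho>
  proof -
    have "finite S"
      using that by (rule finite_subset) (simp add: motzkin_nsteps_def)
    moreover have "Min s \<in> {-1, 0, 1} \<and> Max s \<in> {-1, 0, 1} \<and> Min s \<le> Max s" if "s \<in> motzkin_nsteps" for s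
      using that unfolding motzkin_nsteps_def by auto
    ultimately show ?thesis
      unfolding U_def W_def using that by (intro bridge_gf_multiquadratic) auto
  qed
  \<comment> \<open>Exponents can be negative, so adding them requires nonzero variables.\<close>
  have var: "var_x \<noteq> 0" "var_y \<noteq> 0"
    by (simp_all add: var_x_def var_y_def)
  have weight: "prod_list (map \<omega> w) = var_x powi sum_list (map Min w) * var_y powi sum_list (map Max w)" for w
    using var by (simp add: \<omega>_def prod_list_map_mult prod_list_powi)
  have weight': "prod_list (map \<omega>' w) =
      (if even (sum_list (map Min w)) then prod_list (map \<omega> w) else - prod_list (map \<omega> w))" for w
    by (simp add: \<omega>'_def prod_list_map_mult prod_list_powi)

  have "motzkin_nbridge_gf = U motzkin_nsteps \<omega> -
      fps_const (1/2) * (U parity_nsteps \<omega> - U parity_nsteps \<omega>')"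
  proof (rule fps_ext)
    fix n
    let ?A = "W motzkin_nsteps n" and ?T = "W parity_nsteps n"
    let ?C = "{w \<in> ?T. odd (sum_list (map Min w))}"
    have "?A \<subseteq> {w. set w \<subseteq> motzkin_nsteps \<and> length w = n}"
      by (auto simp: W_def)
    then have fin: "finite ?A"
      by (rule finite_subset) (simp add: finite_lists_length_eq motzkin_nsteps_def)
    have TA: "?T \<subseteq> ?A"
      using sub by (auto simp: W_def)
    have "{w. w \<in> motzkin_nbridges \<and> length w = n} = ?A - ?C"
      using bridge_iff sub unfolding motzkin_nwalks_def
      by (fastforce simp: W_def motzkin_nbridges_def motzkin_nwalks_def)
    then have "fps_nth motzkin_nbridge_gf n =
        (\<Sum>w\<in>?A - ?C. var_x powi min_reach w * var_y powi max_reach w)"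
      by (simp add: motzkin_nbridge_gf_def)
    also have "\<dots> = (\<Sum>w\<in>?A - ?C. prod_list (map \<omega> w))"
      by (intro sum.cong) (auto simp: weight W_def min_max_reach motzkin_nwalks_def)
    also have "\<dots> = (\<Sum>w\<in>?A. prod_list (map \<omega> w)) - (\<Sum>w\<in>?C. prod_list (map \<omega> w))"
      using fin TA by (intro sum_diff) auto
    also have "(\<Sum>w\<in>?C. prod_list (map \<omega> w)) =
        (\<Sum>w\<in>?T. if odd (sum_list (map Min w)) then prod_list (map \<omega> w) else 0)"
      using fin TA by (intro sum.inter_filter) (rule finite_subset)
    \<comment> \<open>The two weights cancel at an even minimum and add up at an odd one, hence the
      factor 1/2.\<close>
    also have "\<dots> = (\<Sum>w\<in>?T. 1/2 * (prod_list (map \<omega> w) - prod_list (map \<omega>' w)))"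
      by (intro sum.cong) (auto simp: weight')
    also have "\<dots> = 1/2 * ((\<Sum>w\<in>?T. prod_list (map \<omega> w)) - (\<Sum>w\<in>?T. prod_list (map \<omega>' w)))"
      by (simp only: sum_distrib_left[symmetric] sum_subtractf)
    finally show "fps_nth motzkin_nbridge_gf n = fps_nth (U motzkin_nsteps \<omega> -
        fps_const (1/2) * (U parity_nsteps \<omega> - U parity_nsteps \<omega>')) n"
      by (simp add: U_def)
  qed
  also have "\<dots> \<in> multiquadratic rational_series"
    using sub by (intro multiquadratic_intros U subsetD[OF subset_multiquadratic fps_const_rational]) auto
  finally show ?thesis
    by (intro algebraic_series_if_integral integral_over_multiquadratic is_subring_rational_series)
qed

end
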